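(* Let $\boldsymbol y_{E_S}=(y_{ij})_{(i,j)\in E_S}$ be the observed scores, let $$L_{NR}(\boldsymbol y_{E_S};\boldsymbol\theta,\boldsymbol\gamma):=\prod_{i=1}^N\mathbb P(\boldsymbol Y_{N_i^I}=\boldsymbol y_{N_i^I};\boldsymbol\theta,\boldsymbol\gamma)$$ be the node-based relaxed likelihood, and let the JPH-NR estimator be $(\hat{\boldsymbol\theta}_{NR},\hat{\boldsymbol\gamma}_{NR}):=\operatorname{argmax}_{(\boldsymbol\theta,\boldsymbol\gamma)\in\mathcal S_\Theta\times\mathcal S_\Gamma}L_{NR}(\boldsymbol y_{E_S};\boldsymbol\theta,\boldsymbol\gamma)$. Then $$(\hat{\boldsymbol\theta}_{NR},\hat{\boldsymbol\gamma}_{NR})=\operatorname*{argmax}_{(\boldsymbol\theta,\boldsymbol\gamma)\in\mathcal S_\Theta\times\mathcal S_\Gamma}\ \sum_{i=1}^N g(\boldsymbol\theta,\boldsymbol\gamma;\boldsymbol n_i)$$ (the two maximization problems have the same set of maximizers), where $\boldsymbol n_i=[n_i^{(1)}\cdots n_i^{(R)}]^\top$, $n_i^{(h)}:=|\{j\in N_i^I: y_{ji}=r_h\}|$, and $$g(\boldsymbol\theta,\boldsymbol\gamma;\boldsymbol n_i)=\log\Big(\sum_{\ell=1}^C p_\ell(\boldsymbol\gamma)\prod_{h=1}^R\Big(\sum_{m=1}^C p_{h|m,\ell}(\boldsymbol\theta)\,p_m(\boldsymbol\gamma)\Big)^{n_i^{(h)}}\Big).$$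
   Context: Score graph: $G_S=(\{1,\dots,N\},E_S)$ is a digraph without self-loops; $(i,j)\in E_S$ means that agent $i$ evaluates agent $j$. Every node has at least one incoming edge. States take values in a finite set $\mathcal C=\{c_1,\dots,c_C\}$ with $C$ elements and scores in a finite set $\mathcal R=\{r_1,\dots,r_R\}$ with $R$ elements. Probabilistic model: each agent $i$ has a random state $X_i\in\mathcal C$ and each edge $(i,j)\in E_S$ has a random score $Y_{ij}\in\mathcal R$ (given by $i$ to $j$), with realization $y_{ij}$. The joint law, depending on a parameter $\boldsymbol\theta$ and a hyperparameter $\boldsymbol\gamma$, factorizes as $$\mathbb P\big((Y_{ij})_{(i,j)\in E_S},X_1,\dots,X_N\big)=\Big(\prod_{(i,j)\in E_S}\mathbb P(Y_{ij}\mid X_i,X_j)\Big)\Big(\prod_{i=1}^N\mathbb P(X_i)\Big),$$ where $\mathbb P(Y_{ij}=r_h\mid X_i=c_\ell,X_j=c_m;\boldsymbol\theta)=p_{h|\ell,m}(\boldsymbol\theta)$ for all $(i,j)\in E_S$ and $\mathbb P(X_i=c_\ell;\boldsymbol\gamma)=p_\ell(\boldsymbol\gamma)$ for all $i$, with given continuous functions $p_{h|\ell,m}$ on a set $\Theta$ and $p_\ell$ on a set $\Gamma$. The feasible sets are $\mathcal S_\Theta=\{\boldsymbol\theta\in\Theta: p_{h|\ell,m}(\boldsymbol\theta)\in[0,1],\ \sum_{h=1}^R p_{h|\ell,m}(\boldsymbol\theta)=1\ \text{for all } h,\ell,m\}$ and $\mathcal S_\Gamma=\{\boldsymbol\gamma\in\Gamma: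 p_\ell(\boldsymbol\gamma)\in[0,1]\ \text{for all }\ell,\ \sum_{\ell=1}^C p_\ell(\boldsymbol\gamma)=1\}$. $N_i^I=\{j:(j,i)\in E_S\}$ is the set of in-neighbors of $i$; $\boldsymbol Y_{N_i^I}$ is the random vector of scores $Y_{ji}$, $j\in N_i^I$, received by $i$, and $\boldsymbol y_{N_i^I}$ its realization. The probabilities $\mathbb P(\boldsymbol Y_{N_i^I}=\boldsymbol y_{N_i^I};\boldsymbol\theta,\boldsymbol\gamma)$ are marginals of the joint law above. Conventions: $0^0=1$, $\log 0=-\infty$. *)

theory Defs
  imports "HOL-Probability.Probability"
begin

type_synonym edges = "(nat \<times> nat) set"

definition score_graph :: "nat \<Rightarrow> edges \<Rightarrow> bool" where
  "score_graph N E \<longleftrightarrow>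
     E \<subseteq> {1..N} \<times> {1..N} \<and> (\<forall>i. (i, i) \<notin> E) \<and> (\<forall>i\<in>{1..N}. \<exists>j. (j, i) \<in> E)"

definition in_nbrs :: "edges \<Rightarrow> nat \<Rightarrow> nat set" where
  "in_nbrs E i = {j. (j, i) \<in> E}"

text \<open>States and scores are enumerated as c 1, ..., c C and r 1, ..., r R.  Throughout,
  p h l m \<theta> is the probability of score r h given by an evaluator in state c l to an evaluated
  agent in state c m, and q l \<gamma> is the probability of state c l.\<close>

definition feasible_theta ::
  "nat \<Rightarrow> nat \<Rightarrow> (nat \<Rightarrow> nat \<Rightarrow> nat \<Rightarrow> 't \<Rightarrow> real) \<Rightarrow> 't set \<Rightarrow> 't set" where
  "feasible_theta C R p \<Theta> =
     {\<theta> \<in> \<Theta>. (\<forall>h\<in>{1..R}. \<forall>l\<in>{1..C}. \<forall>m\<in>{1..C}. p h l m \<theta> \<in> {0..1}) \<and>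
              (\<forall>l\<in>{1..C}. \<forall>m\<in>{1..C}. (\<Sum>h=1..R. p h l m \<theta>) = 1)}"

definition feasible_gamma ::
  "nat \<Rightarrow> (nat \<Rightarrow> 'g \<Rightarrow> real) \<Rightarrow> 'g set \<Rightarrow> 'g set" where
  "feasible_gamma C q \<Gamma> =
     {\<gamma> \<in> \<Gamma>. (\<forall>l\<in>{1..C}. q l \<gamma> \<in> {0..1}) \<and> (\<Sum>l=1..C. q l \<gamma>) = 1}"

text \<open>A conditional probability of a score given the two states is determined by the law only when
  the conditioning event has positive probability, hence the guard in the third clause.  The joint
  law in the last clause uses the kernel p itself, so it is meaningful for null states as well.
  The two clauses before the last are the stated interpretation of q and p.\<close>

definition score_law ::
  "nat \<Rightarrow> edges \<Rightarrow> nat \<Rightarrow> (nat \<Rightarrow> 'c) \<Rightarrow> nat \<Rightarrow> (nat \<Rightarrow> 'r) \<Rightarrow>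
   (nat \<Rightarrow> nat \<Rightarrow> nat \<Rightarrow> 't \<Rightarrow> real) \<Rightarrow> (nat \<Rightarrow> 'g \<Rightarrow> real) \<Rightarrow> 't \<Rightarrow> 'g \<Rightarrow>
   'w measure \<Rightarrow> (nat \<Rightarrow> 'w \<Rightarrow> 'c) \<Rightarrow> (nat \<Rightarrow> nat \<Rightarrow> 'w \<Rightarrow> 'r) \<Rightarrow> bool" where
  "score_law N E C c R r p q \<theta> \<gamma> M X Y \<longleftrightarrow>
     prob_space M \<and>
     (\<forall>i\<in>{1..N}. X i \<in> measurable M (count_space (c ` {1..C}))) \<and>
     (\<forall>(i, j)\<in>E. Y i j \<in> measurable M (count_space (r ` {1..R}))) \<and>
     (\<forall>i\<in>{1..N}. \<forall>l\<in>{1..C}. \<P>(\<omega> in M. X i \<omega> = c l) = q l \<gamma>) \<and>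
     (\<forall>(i, j)\<in>E. \<forall>h\<in>{1..R}. \<forall>l\<in>{1..C}. \<forall>m\<in>{1..C}.
        \<P>(\<omega> in M. X i \<omega> = c l \<and> X j \<omega> = c m) > 0 \<longrightarrow>
        \<P>(\<omega> in M. Y i j \<omega> = r h \<bar> X i \<omega> = c l \<and> X j \<omega> = c m) = p h l m \<theta>) \<and>
     (\<forall>l h. (\<forall>i\<in>{1..N}. l i \<in> {1..C}) \<longrightarrow> (\<forall>(i, j)\<in>E. h i j \<in> {1..R}) \<longrightarrow>
        \<P>(\<omega> in M. (\<forall>(i, j)\<in>E. Y i j \<omega> = r (h i j)) \<and> (\<forall>i\<in>{1..N}. X i \<omega> = c (l i))) =
        (\<Prod>(i, j)\<in>E. p (h i j) (l i) (l j) \<theta>) * (\<Prod>i=1..N. q (l i) \<gamma>))"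

definition L_NR ::
  "nat \<Rightarrow> edges \<Rightarrow> ('t \<Rightarrow> 'g \<Rightarrow> 'w measure) \<Rightarrow> (nat \<Rightarrow> nat \<Rightarrow> 'w \<Rightarrow> 'r) \<Rightarrow>
   (nat \<Rightarrow> nat \<Rightarrow> 'r) \<Rightarrow> 't \<Rightarrow> 'g \<Rightarrow> real" where
  "L_NR N E M Y y \<theta> \<gamma> =
     (\<Prod>i=1..N. \<P>(\<omega> in M \<theta> \<gamma>. \<forall>j\<in>in_nbrs E i. Y j i \<omega> = y j i))"

text \<open>The argmax is the set of all maximizers (possibly empty).\<close>

definition argmax_set :: "'a set \<Rightarrow> ('a \<Rightarrow> 'b::linorder) \<Rightarrow> 'a set" where
  "argmax_set S f = {x. is_arg_max f (\<lambda>z. z \<in> S) x}"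

definition JPH_NR ::
  "nat \<Rightarrow> edges \<Rightarrow> ('t \<Rightarrow> 'g \<Rightarrow> 'w measure) \<Rightarrow> (nat \<Rightarrow> nat \<Rightarrow> 'w \<Rightarrow> 'r) \<Rightarrow>
   (nat \<Rightarrow> nat \<Rightarrow> 'r) \<Rightarrow> 't set \<Rightarrow> 'g set \<Rightarrow> ('t \<times> 'g) set" where
  "JPH_NR N E M Y y S\<^sub>\<Theta> S\<^sub>\<Gamma> = argmax_set (S\<^sub>\<Theta> \<times> S\<^sub>\<Gamma>) (\<lambda>(\<theta>, \<gamma>). L_NR N E M Y y \<theta> \<gamma>)"

definition score_count :: "edges \<Rightarrow> (nat \<Rightarrow> 'r) \<Rightarrow> (nat \<Rightarrow> nat \<Rightarrow> 'r) \<Rightarrow> nat \<Rightarrow> nat \<Rightarrow> nat" where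
  "score_count E r y i h = card {j \<in> in_nbrs E i. y j i = r h}"

text \<open>Logarithm of a nonnegative real with log 0 = -\<infinity>; the library has ln 0 = 0 on the reals.\<close>

definition elog :: "real \<Rightarrow> ereal" where
  "elog x = (if x = 0 then -\<infinity> else ereal (ln x))"

definition g_obj ::
  "nat \<Rightarrow> nat \<Rightarrow> (nat \<Rightarrow> nat \<Rightarrow> nat \<Rightarrow> 't \<Rightarrow> real) \<Rightarrow> (nat \<Rightarrow> 'g \<Rightarrow> real) \<Rightarrow>
   't \<Rightarrow> 'g \<Rightarrow> (nat \<Rightarrow> nat) \<Rightarrow> ereal" where
  "g_obj C R p q \<theta> \<gamma> n =
     elog (\<Sum>l=1..C. q l \<gamma> * (\<Prod>h=1..R. (\<Sum>m=1..C. p h m l \<theta> * q m \<gamma>) ^ n h))"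

end

theory Submission
  imports Defs
begin

text \<open>Expanding the marginal of the scores received by node i over all states and all remaining
  scores, the remaining scores sum out because each kernel has total mass 1. The states of the
  nodes outside i and its in-neighbours then sum out as well, and conditionally on the state of i
  the received scores are independent and identically distributed, so the marginal depends only on
  the score counts. The claim follows by taking logarithms.\<close>

section \<open>Extended logarithm and maximizers\<close>

text \<open>The value -\<infinity> at 0 keeps the logarithm strictly increasing up to the boundary
  of the nonnegative reals.\<close>

lemma elog_less_iff:
  assumes "0 \<le> a" "0 \<le> b"
  shows "elog a < elog b \<longleftrightarrow> a < b"
  using assms by (auto simp: elog_def)

text \<open>No value is +\<infinity>, so a zero factor makes the sum -\<infinity>, matching the
  logarithm of a zero product.\<close>

lemma elog_mult:
  assumes "0 \<le> a" "0 \<le> b"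
  shows "elog (a * b) = elog a + elog b"
  using assms by (auto simp: elog_def ln_mult)

lemma elog_prod:
  assumes "\<And>i. i \<in> A \<Longrightarrow> 0 \<le> f i"
  shows "elog (\<Prod>i\<in>A. f i) = (\<Sum>i\<in>A. elog (f i))"
  using assms
proof (induction A rule: infinite_finite_induct)
  case (insert x F)
  then show ?case
    by (simp add: elog_mult prod_nonneg)
\<comment> \<open>Over an infinite set the product is 1 and the sum is 0, exactly as over the empty
  set.\<close>
qed (simp_all add: elog_def zero_ereal_def)

text \<open>\<open>is_arg_max\<close> refers only to strict comparisons between points of
  \<open>S\<close>, so the two objectives may even take values in different orders, here
  \<open>real\<close> and \<open>ereal\<close>.\<close>

lemma argmax_set_cong_less:
  assumes "\<And>x z. x \<in> S \<Longrightarrow> z \<in> S \<Longrightarrow> f x < f z \<longleftrightarrow> g x < g z"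
  shows "argmax_set S f = argmax_set S g"
  using assms by (auto simp: argmax_set_def is_arg_max_def)

section \<open>Products over fibres and sums over a star\<close>

text \<open>The factor is constant on each fibre of \<open>\<eta>\<close>. This is how score counts
  become exponents.\<close>

lemma prod_eq_prod_power_card:
  fixes f :: "'b \<Rightarrow> 'a::comm_monoid_mult"
  assumes "finite J" "finite K" "\<eta> ` J \<subseteq> K"
  shows "(\<Prod>j\<in>J. f (\<eta> j)) = (\<Prod>k\<in>K. f k ^ card {j \<in> J. \<eta> j = k})"
proof -
  have "(\<Prod>j\<in>J. f (\<eta> j)) = (\<Prod>k\<in>K. \<Prod>j\<in>{j \<in> J. \<eta> j = k}. f (\<eta> j))"
    using prod.group[OF assms, of "\<lambda>j. f (\<eta> j)"] by simp
  also have "\<dots> = (\<Prod>k\<in>K. f k ^ card {j \<in> J. \<eta> j = k})"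
    by (intro prod.cong) simp_all
  finally show ?thesis .
qed

text \<open>Each weight couples one leaf in \<open>J\<close> to the centre \<open>i\<close>. Once
  the state of the centre is fixed, the summand factorizes over the nodes, and every node outside
  the star contributes the total mass 1 of \<open>q\<close>.\<close>

lemma sum_PiE_star:
  fixes q :: "'b \<Rightarrow> 'a::comm_semiring_1" and w :: "'i \<Rightarrow> 'b \<Rightarrow> 'b \<Rightarrow> 'a"
  assumes V: "finite V" and S: "finite S" and i: "i \<in> V" and J: "J \<subseteq> V - {i}"
    and q1: "(\<Sum>s\<in>S. q s) = 1"
  shows "(\<Sum>l\<in>PiE V (\<lambda>_. S). (\<Prod>j\<in>J. w j (l j) (l i)) * (\<Prod>k\<in>V. q (l k))) =
    (\<Sum>s\<in>S. q s * (\<Prod>j\<in>J. \<Sum>t\<in>S. w j t s * q t))"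
proof -
  let ?P = "PiE V (\<lambda>_. S)"
  have "(\<Sum>l\<in>?P. (\<Prod>j\<in>J. w j (l j) (l i)) * (\<Prod>k\<in>V. q (l k))) =
    (\<Sum>s\<in>S. \<Sum>l\<in>{l \<in> ?P. l i = s}. (\<Prod>j\<in>J. w j (l j) (l i)) * (\<Prod>k\<in>V. q (l k)))"
    using i by (intro sum.group[symmetric] finite_PiE V S) auto
  also have "\<dots> = (\<Sum>s\<in>S. q s * (\<Prod>j\<in>J. \<Sum>t\<in>S. w j t s * q t))"
  proof (rule sum.cong[OF refl])
    fix s assume s: "s \<in> S"
    \<comment> \<open>Pinning the centre to \<open>s\<close> leaves a product set, and
      \<open>?f\<close> gives every node of \<open>V\<close> one factor, so that the sum of products
      becomes a product of sums.\<close>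
    let ?B = "\<lambda>k. if k = i then {s} else S"
    let ?f = "\<lambda>k t. (if k \<in> J then w k t s else 1) * q t"
    have fib: "{l \<in> ?P. l i = s} = PiE V ?B"
      using i s by (auto simp: PiE_iff extensional_def split: if_splits)
    have "(\<Sum>l\<in>{l \<in> ?P. l i = s}. (\<Prod>j\<in>J. w j (l j) (l i)) * (\<Prod>k\<in>V. q (l k))) =
      (\<Sum>l\<in>PiE V ?B. \<Prod>k\<in>V. ?f k (l k))"
    proof (rule sum.cong[OF fib])
      fix l assume "l \<in> PiE V ?B"
      then have l: "l i = s" using i by (auto simp: PiE_iff split: if_splits)
      have "(\<Prod>j\<in>J. w j (l j) s) = (\<Prod>k\<in>V. if k \<in> J then w k (l k) s else 1)"
        using J V by (intro prod.mono_neutral_cong_left) auto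
      then show "(\<Prod>j\<in>J. w j (l j) (l i)) * (\<Prod>k\<in>V. q (l k)) = (\<Prod>k\<in>V. ?f k (l k))"
        by (simp add: l prod.distrib)
    qed
    also have "\<dots> = (\<Prod>k\<in>V. \<Sum>t\<in>?B k. ?f k t)"
      using V S by (intro prod_sum_PiE[symmetric]) auto
    \<comment> \<open>Since \<open>i\<close> is not in \<open>J\<close>, the centre contributes no
      weight \<open>w\<close>, only \<open>q s\<close>.\<close>
    also have "\<dots> = q s * (\<Prod>k\<in>V - {i}. \<Sum>t\<in>?B k. ?f k t)"
      using J by (subst prod.remove[OF V i]) auto
    also have "(\<Prod>k\<in>V - {i}. \<Sum>t\<in>?B k. ?f k t) = (\<Prod>j\<in>J. \<Sum>t\<in>S. w j t s * q t)"
      using J V q1 by (intro prod.mono_neutral_cong_right) auto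
    finally show "(\<Sum>l\<in>{l \<in> ?P. l i = s}. (\<Prod>j\<in>J. w j (l j) (l i)) * (\<Prod>k\<in>V. q (l k))) =
      q s * (\<Prod>j\<in>J. \<Sum>t\<in>S. w j t s * q t)" .
  qed
  finally show ?thesis .
qed

section \<open>Score probabilities from the joint law\<close>

text \<open>The value \<open>a\<close> may lie outside \<open>A\<close>; the preimage of
  \<open>{a} \<inter> A\<close> covers both cases.\<close>

lemma sets_Collect_eq_count_space:
  assumes "f \<in> measurable M (count_space A)"
  shows "{\<omega> \<in> space M. f \<omega> = a} \<in> sets M"
proof -
  have "{\<omega> \<in> space M. f \<omega> = a} = f -` ({a} \<inter> A) \<inter> space M"
    using measurable_space[OF assms] by auto
  then show ?thesis
    using measurable_sets[OF assms, of "{a} \<inter> A"] by simp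
qed

text \<open>The absence of self-loops makes \<open>i\<close> and its in-neighbours a star in the
  sense of \<open>sum_PiE_star\<close>.\<close>

lemma in_nbrs_subset:
  assumes "score_graph N E"
  shows "in_nbrs E i \<subseteq> {1..N} - {i}"
  using assms by (auto simp: score_graph_def in_nbrs_def)

text \<open>The event is a finite disjoint union of atoms on which all states and scores are fixed,
  and the joint law gives the probability of each atom. A singleton \<open>H e\<close> prescribes
  the score on \<open>e\<close>; the full range \<open>{1..R}\<close> leaves it free.\<close>

lemma prob_scores_expand:
  assumes law: "score_law N E C c R r p q \<theta> \<gamma> M X Y"
    and E: "finite E"
    and c: "inj_on c {1..C}" and r: "inj_on r {1..R}"
    and H: "\<And>e. e \<in> E \<Longrightarrow> H e \<subseteq> {1..R}"
  shows "\<P>(\<omega> in M. \<forall>(i, j)\<in>E. Y i j \<omega> \<in> r ` H (i, j)) =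
    (\<Sum>l\<in>PiE {1..N} (\<lambda>_. {1..C}). \<Sum>h\<in>PiE E H.
       (\<Prod>(i, j)\<in>E. p (h (i, j)) (l i) (l j) \<theta>) * (\<Prod>i=1..N. q (l i) \<gamma>))"
proof -
  interpret prob_space M using law by (simp add: score_law_def)
  have X: "X i \<in> measurable M (count_space (c ` {1..C}))" if "i \<in> {1..N}" for i
    using law that by (simp add: score_law_def)
  have Y: "Y i j \<in> measurable M (count_space (r ` {1..R}))" if "(i, j) \<in> E" for i j
    using law that by (auto simp: score_law_def)
  have joint: "\<P>(\<omega> in M. (\<forall>(i, j)\<in>E. Y i j \<omega> = r (h i j)) \<and> (\<forall>i\<in>{1..N}. X i \<omega> = c (l i))) =
        (\<Prod>(i, j)\<in>E. p (h i j) (l i) (l j) \<theta>) * (\<Prod>i=1..N. q (l i) \<gamma>)"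
    if "\<forall>i\<in>{1..N}. l i \<in> {1..C}" "\<forall>(i, j)\<in>E. h i j \<in> {1..R}" for l h
    using law that unfolding score_law_def by blast
  \<comment> \<open>Extensional functions give finitely many indices, without repeating an atom
    under functions that differ only off the domain.\<close>
  let ?L = "PiE {1..N} (\<lambda>_. {1..C})" and ?H = "PiE E H"
  let ?A = "\<lambda>(l, h). {\<omega> \<in> space M. (\<forall>(i, j)\<in>E. Y i j \<omega> = r (h (i, j))) \<and>
    (\<forall>i\<in>{1..N}. X i \<omega> = c (l i))}"
  have fH: "finite (H e)" if "e \<in> E" for e
    using H[OF that] finite_subset by blast
  have fin: "finite (?L \<times> ?H)"
    using E fH by (intro finite_cartesian_product finite_PiE) auto
  note Xs = sets_Collect_eq_count_space[OF X]
  note Ys = sets_Collect_eq_count_space[OF Y]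
  have meas: "?A x \<in> sets M" for x
  proof (cases x)
    case (Pair l h)
    have "{\<omega> \<in> space M. \<forall>(i, j)\<in>E. Y i j \<omega> = r (h (i, j))} \<in> sets M"
      using E Ys by (intro sets.sets_Collect_finite_All) (auto simp: split_beta)
    moreover have "{\<omega> \<in> space M. \<forall>i\<in>{1..N}. X i \<omega> = c (l i)} \<in> sets M"
      using Xs by (intro sets.sets_Collect_finite_All) auto
    ultimately show ?thesis
      unfolding Pair prod.case by (rule sets.sets_Collect_conj[rotated])
  qed
  \<comment> \<open>An outcome common to two atoms forces equal labels, and injectivity of
    \<open>c\<close> and \<open>r\<close> turns these into equal indices.\<close>
  have disj: "disjoint_family_on ?A (?L \<times> ?H)"
  proof (unfold disjoint_family_on_def, intro ballI impI, rule ccontr)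
    fix x x' assume x: "x \<in> ?L \<times> ?H" "x' \<in> ?L \<times> ?H" "x \<noteq> x'" "?A x \<inter> ?A x' \<noteq> {}"
    obtain l h l' h' where eq: "x = (l, h)" "x' = (l', h')" by fastforce
    from x(4) obtain \<omega> where "\<omega> \<in> ?A (l, h)" "\<omega> \<in> ?A (l', h')"
      unfolding eq by blast
    then have w: "\<And>i j. (i, j) \<in> E \<Longrightarrow> r (h (i, j)) = r (h' (i, j))"
      "\<And>i. i \<in> {1..N} \<Longrightarrow> c (l i) = c (l' i)"
      by (auto 0 3)
    have "l = l'"
    proof (rule PiE_ext)
      show l: "l \<in> ?L" "l' \<in> ?L" using x eq by auto
      show "l i = l' i" if "i \<in> {1..N}" for i
        by (rule inj_onD[OF c w(2)[OF that] PiE_mem[OF l(1) that] PiE_mem[OF l(2) that]])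
    qed
    moreover have "h = h'"
    proof (rule PiE_ext)
      show h: "h \<in> ?H" "h' \<in> ?H" using x eq by auto
      show "h e = h' e" if "e \<in> E" for e
      proof -
        have "h e \<in> {1..R}" "h' e \<in> {1..R}"
          using H[OF that] PiE_mem[OF h(1) that] PiE_mem[OF h(2) that] by auto
        moreover have "r (h e) = r (h' e)" using w(1)[of "fst e" "snd e"] that by simp
        ultimately show ?thesis using inj_onD[OF r] by blast
      qed
    qed
    ultimately show False using x eq by simp
  qed
  have union: "{\<omega> \<in> space M. \<forall>(i, j)\<in>E. Y i j \<omega> \<in> r ` H (i, j)} = (\<Union>x\<in>?L \<times> ?H. ?A x)"
  proof (intro equalityI subsetI)
    fix \<omega> assume w: "\<omega> \<in> {\<omega> \<in> space M. \<forall>(i, j)\<in>E. Y i j \<omega> \<in> r ` H (i, j)}"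
    then have "\<forall>e\<in>E. \<exists>k. k \<in> H e \<and> Y (fst e) (snd e) \<omega> = r k" by fastforce
    then obtain h where h: "\<And>e. e \<in> E \<Longrightarrow> h e \<in> H e \<and> Y (fst e) (snd e) \<omega> = r (h e)" by metis
    have "\<forall>i\<in>{1..N}. \<exists>k. k \<in> {1..C} \<and> X i \<omega> = c k"
    proof
      fix i assume "i \<in> {1..N}"
      then have "X i \<omega> \<in> c ` {1..C}" using measurable_space[OF X, of i \<omega>] w by simp
      then show "\<exists>k. k \<in> {1..C} \<and> X i \<omega> = c k" by blast
    qed
    then obtain l where l: "\<And>i. i \<in> {1..N} \<Longrightarrow> l i \<in> {1..C} \<and> X i \<omega> = c (l i)" by metis
    have "(restrict l {1..N}, restrict h E) \<in> ?L \<times> ?H" using l h by auto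
    moreover have "\<omega> \<in> ?A (restrict l {1..N}, restrict h E)"
    proof -
      have "Y j k \<omega> = r (h (j, k))" if "(j, k) \<in> E" for j k using h[OF that] by simp
      then show ?thesis using w l by auto
    qed
    ultimately show "\<omega> \<in> (\<Union>x\<in>?L \<times> ?H. ?A x)" by blast
  next
    fix \<omega> assume "\<omega> \<in> (\<Union>x\<in>?L \<times> ?H. ?A x)"
    then obtain l h where h: "h \<in> ?H" and w: "\<omega> \<in> ?A (l, h)" by blast
    have "Y j k \<omega> \<in> r ` H (j, k)" if "(j, k) \<in> E" for j k
    proof -
      have "Y j k \<omega> = r (h (j, k))" using w that by blast
      then show ?thesis using PiE_mem[OF h that] by simp
    qed
    then show "\<omega> \<in> {\<omega> \<in> space M. \<forall>(i, j)\<in>E. Y i j \<omega> \<in> r ` H (i, j)}" using w by auto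
  qed
  have "\<P>(\<omega> in M. \<forall>(i, j)\<in>E. Y i j \<omega> \<in> r ` H (i, j)) = (\<Sum>x\<in>?L \<times> ?H. prob (?A x))"
    unfolding union using fin disj meas by (intro finite_measure_finite_Union) auto
  also have "\<dots> = (\<Sum>l\<in>?L. \<Sum>h\<in>?H. prob (?A (l, h)))"
    by (simp add: sum.cartesian_product split_beta)
  also have "\<dots> = (\<Sum>l\<in>?L. \<Sum>h\<in>?H.
    (\<Prod>(i, j)\<in>E. p (h (i, j)) (l i) (l j) \<theta>) * (\<Prod>i=1..N. q (l i) \<gamma>))"
  proof (intro sum.cong refl)
    fix l h assume l: "l \<in> ?L" and h: "h \<in> ?H"
    have "\<forall>i\<in>{1..N}. l i \<in> {1..C}" using PiE_mem[OF l] by blast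
    moreover have "\<forall>(i, j)\<in>E. h (i, j) \<in> {1..R}" using h H by (blast dest: PiE_mem)
    ultimately show "prob (?A (l, h)) =
      (\<Prod>(i, j)\<in>E. p (h (i, j)) (l i) (l j) \<theta>) * (\<Prod>i=1..N. q (l i) \<gamma>)"
      using joint[of l "\<lambda>i j. h (i, j)"] by (simp only: prod.case)
  qed
  finally show ?thesis .
qed

section \<open>Marginal of the scores received by one node\<close>

text \<open>In \<open>p h m l\<close> the state \<open>l\<close> belongs to the evaluated node
  \<open>i\<close> and \<open>m\<close> to an evaluator. Given \<open>l\<close>, averaging over
  \<open>m\<close> yields the same score distribution for every in-neighbour, so only the counts
  remain.\<close>

lemma prob_received_scores:
  assumes graph: "score_graph N E" and i: "i \<in> {1..N}"
    and c: "inj_on c {1..C}" and r: "inj_on r {1..R}"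
    and \<theta>: "\<theta> \<in> feasible_theta C R p \<Theta>" and \<gamma>: "\<gamma> \<in> feasible_gamma C q \<Gamma>"
    and law: "score_law N E C c R r p q \<theta> \<gamma> M X Y"
    and observed: "\<And>j. (j, i) \<in> E \<Longrightarrow> y j i \<in> r ` {1..R}"
  shows "\<P>(\<omega> in M. \<forall>j\<in>in_nbrs E i. Y j i \<omega> = y j i) =
    (\<Sum>l=1..C. q l \<gamma> * (\<Prod>h=1..R. (\<Sum>m=1..C. p h m l \<theta> * q m \<gamma>) ^ score_count E r y i h))"
proof -
  let ?J = "in_nbrs E i"
  let ?L = "PiE {1..N} (\<lambda>_. {1..C})"
  have E: "finite E"
    using graph finite_subset[of E "{1..N} \<times> {1..N}"] by (auto simp: score_graph_def)
  have EN: "E \<subseteq> {1..N} \<times> {1..N}" using graph by (simp add: score_graph_def)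
  have J: "?J \<subseteq> {1..N} - {i}" by (rule in_nbrs_subset[OF graph])
  then have fJ: "finite ?J" by (rule finite_subset) simp
  have "\<forall>j\<in>?J. \<exists>k. k \<in> {1..R} \<and> y j i = r k"
    using observed by (fastforce simp: in_nbrs_def)
  then obtain \<eta> where \<eta>: "\<And>j. j \<in> ?J \<Longrightarrow> \<eta> j \<in> {1..R}" "\<And>j. j \<in> ?J \<Longrightarrow> y j i = r (\<eta> j)"
    by metis
  \<comment> \<open>Edges into \<open>i\<close> carry their observed score; on all other edges the
    constraint is vacuous because \<open>Y\<close> takes values in the score set.\<close>
  define H where "H = (\<lambda>e::nat \<times> nat. if snd e = i then {\<eta> (fst e)} else {1..R})"
  have H: "H e \<subseteq> {1..R}" if "e \<in> E" for e
    using \<eta>(1)[of "fst e"] that by (cases e) (auto simp: H_def in_nbrs_def)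
  have fH: "finite (H e)" for e by (simp add: H_def)
  have Y: "Y j k \<omega> \<in> r ` {1..R}" if "(j, k) \<in> E" "\<omega> \<in> space M" for j k \<omega>
  proof -
    have "Y j k \<in> measurable M (count_space (r ` {1..R}))"
      using law that(1) unfolding score_law_def by blast
    from measurable_space[OF this that(2)] show ?thesis by simp
  qed
  have "{\<omega> \<in> space M. \<forall>j\<in>?J. Y j i \<omega> = y j i} =
    {\<omega> \<in> space M. \<forall>(j, k)\<in>E. Y j k \<omega> \<in> r ` H (j, k)}"
  proof (intro Collect_cong conj_cong refl)
    fix \<omega> assume w: "\<omega> \<in> space M"
    have "Y j k \<omega> \<in> r ` H (j, k) \<longleftrightarrow> (k = i \<longrightarrow> Y j i \<omega> = y j i)" if "(j, k) \<in> E" for j k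
      using Y[OF that w] \<eta>(2)[of j] that by (auto simp: H_def in_nbrs_def)
    then show "(\<forall>j\<in>?J. Y j i \<omega> = y j i) \<longleftrightarrow> (\<forall>(j, k)\<in>E. Y j k \<omega> \<in> r ` H (j, k))"
      unfolding in_nbrs_def by blast
  qed
  then have "\<P>(\<omega> in M. \<forall>j\<in>?J. Y j i \<omega> = y j i) =
    (\<Sum>l\<in>?L. \<Sum>h\<in>PiE E H.
       (\<Prod>(j, k)\<in>E. p (h (j, k)) (l j) (l k) \<theta>) * (\<Prod>k=1..N. q (l k) \<gamma>))"
    using prob_scores_expand[OF law E c r H] by simp
  also have "\<dots> = (\<Sum>l\<in>?L. (\<Prod>j\<in>?J. p (\<eta> j) (l j) (l i) \<theta>) * (\<Prod>k=1..N. q (l k) \<gamma>))"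
  proof (rule sum.cong[OF refl])
    fix l assume l: "l \<in> ?L"
    let ?w = "\<lambda>e k. p k (l (fst e)) (l (snd e)) \<theta>"
    \<comment> \<open>For fixed states the scores on different edges are summed
      independently.\<close>
    have "(\<Sum>h\<in>PiE E H. \<Prod>(j, k)\<in>E. p (h (j, k)) (l j) (l k) \<theta>) = (\<Prod>e\<in>E. \<Sum>k\<in>H e. ?w e k)"
      using E fH by (subst prod_sum_PiE) (auto simp: split_beta)
    also have "\<dots> = (\<Prod>e\<in>(\<lambda>j. (j, i)) ` ?J. ?w e (\<eta> (fst e)))"
    proof (intro prod.mono_neutral_cong_right E ballI)
      show "(\<lambda>j. (j, i)) ` ?J \<subseteq> E" by (auto simp: in_nbrs_def)
      show "(\<Sum>k\<in>H e. ?w e k) = ?w e (\<eta> (fst e))" if "e \<in> (\<lambda>j. (j, i)) ` ?J" for e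
        using that by (auto simp: H_def)
      \<comment> \<open>An edge not ending in \<open>i\<close> is summed over all scores, where
        feasibility of \<theta> gives total mass 1.\<close>
      show "(\<Sum>k\<in>H e. ?w e k) = 1" if e: "e \<in> E - (\<lambda>j. (j, i)) ` ?J" for e
      proof -
        have "snd e \<noteq> i" using e by (cases e) (auto simp: in_nbrs_def)
        moreover have "fst e \<in> {1..N}" "snd e \<in> {1..N}" using e EN by auto
        then have "l (fst e) \<in> {1..C}" "l (snd e) \<in> {1..C}" using PiE_mem[OF l] by blast+
        ultimately show ?thesis using \<theta> by (simp add: H_def feasible_theta_def)
      qed
    qed
    also have "\<dots> = (\<Prod>j\<in>?J. p (\<eta> j) (l j) (l i) \<theta>)"
      by (subst prod.reindex) (auto simp: inj_on_def)
    finally show "(\<Sum>h\<in>PiE E H.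
        (\<Prod>(j, k)\<in>E. p (h (j, k)) (l j) (l k) \<theta>) * (\<Prod>k=1..N. q (l k) \<gamma>)) =
      (\<Prod>j\<in>?J. p (\<eta> j) (l j) (l i) \<theta>) * (\<Prod>k=1..N. q (l k) \<gamma>)"
      by (simp add: sum_distrib_right[symmetric])
  qed
  \<comment> \<open>The remaining sum over states is the star sum with centre \<open>i\<close> and
    leaves \<open>?J\<close>; feasibility of \<gamma> supplies the mass 1.\<close>
  also have "\<dots> = (\<Sum>l=1..C. q l \<gamma> * (\<Prod>j\<in>?J. \<Sum>m=1..C. p (\<eta> j) m l \<theta> * q m \<gamma>))"
    using \<gamma> by (intro sum_PiE_star[OF _ _ i J]) (auto simp: feasible_gamma_def)
  also have "\<dots> = (\<Sum>l=1..C. q l \<gamma> *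
      (\<Prod>h=1..R. (\<Sum>m=1..C. p h m l \<theta> * q m \<gamma>) ^ score_count E r y i h))"
  proof (intro sum.cong refl arg_cong2[where f = "(*)"])
    fix l
    have "(\<Prod>j\<in>?J. \<Sum>m=1..C. p (\<eta> j) m l \<theta> * q m \<gamma>) =
      (\<Prod>h=1..R. (\<Sum>m=1..C. p h m l \<theta> * q m \<gamma>) ^ card {j \<in> ?J. \<eta> j = h})"
      using \<eta>(1) fJ by (intro prod_eq_prod_power_card) auto
    also have "\<dots> = (\<Prod>h=1..R. (\<Sum>m=1..C. p h m l \<theta> * q m \<gamma>) ^ score_count E r y i h)"
    proof (rule prod.cong[OF refl])
      fix h assume h: "h \<in> {1..R}"
      \<comment> \<open>Counting indices agrees with counting scores because \<open>r\<close> is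
        injective on \<open>{1..R}\<close>.\<close>
      have "{j \<in> ?J. \<eta> j = h} = {j \<in> ?J. y j i = r h}"
        using \<eta> inj_onD[OF r] h by auto
      then show "(\<Sum>m=1..C. p h m l \<theta> * q m \<gamma>) ^ card {j \<in> ?J. \<eta> j = h} =
        (\<Sum>m=1..C. p h m l \<theta> * q m \<gamma>) ^ score_count E r y i h"
        by (simp add: score_count_def)
    qed
    finally show "(\<Prod>j\<in>?J. \<Sum>m=1..C. p (\<eta> j) m l \<theta> * q m \<gamma>) =
      (\<Prod>h=1..R. (\<Sum>m=1..C. p h m l \<theta> * q m \<gamma>) ^ score_count E r y i h)" .
  qed
  finally show ?thesis .
qed

section \<open>Equality of the two sets of maximizers\<close>

theorem mainTheorem2:
  fixes N C R :: nat and E :: edges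
    and c :: "nat \<Rightarrow> 'c" and r :: "nat \<Rightarrow> 'r"
    and p :: "nat \<Rightarrow> nat \<Rightarrow> nat \<Rightarrow> 't::topological_space \<Rightarrow> real"
    and q :: "nat \<Rightarrow> 'g::topological_space \<Rightarrow> real"
    and \<Theta> :: "'t set" and \<Gamma> :: "'g set"
    and M :: "'t \<Rightarrow> 'g \<Rightarrow> 'w measure"
    and X :: "nat \<Rightarrow> 'w \<Rightarrow> 'c" and Y :: "nat \<Rightarrow> nat \<Rightarrow> 'w \<Rightarrow> 'r"
    and y :: "nat \<Rightarrow> nat \<Rightarrow> 'r"
  defines "S\<^sub>\<Theta> \<equiv> feasible_theta C R p \<Theta>"
    and "S\<^sub>\<Gamma> \<equiv> feasible_gamma C q \<Gamma>"
  assumes graph: "score_graph N E"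
    and states: "inj_on c {1..C}"
    and scores: "inj_on r {1..R}"
    and cont_p: "\<And>h l m. h \<in> {1..R} \<Longrightarrow> l \<in> {1..C} \<Longrightarrow> m \<in> {1..C} \<Longrightarrow> continuous_on \<Theta> (p h l m)"
    and cont_q: "\<And>l. l \<in> {1..C} \<Longrightarrow> continuous_on \<Gamma> (q l)"
    and law: "\<And>\<theta> \<gamma>. \<theta> \<in> S\<^sub>\<Theta> \<Longrightarrow> \<gamma> \<in> S\<^sub>\<Gamma> \<Longrightarrow> score_law N E C c R r p q \<theta> \<gamma> (M \<theta> \<gamma>) X Y"
    and observed: "\<And>i j. (i, j) \<in> E \<Longrightarrow> y i j \<in> r ` {1..R}"
  shows "JPH_NR N E M Y y S\<^sub>\<Theta> S\<^sub>\<Gamma> =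
    argmax_set (S\<^sub>\<Theta> \<times> S\<^sub>\<Gamma>)
      (\<lambda>(\<theta>, \<gamma>). \<Sum>i=1..N. g_obj C R p q \<theta> \<gamma> (score_count E r y i))"
proof -
  \<comment> \<open>On the feasible set the objective is exactly the logarithm of the likelihood,
    including points of likelihood 0, where both sides are -\<infinity>.\<close>
  have elog_L: "elog (L_NR N E M Y y \<theta> \<gamma>) =
      (\<Sum>i=1..N. g_obj C R p q \<theta> \<gamma> (score_count E r y i))"
    if \<theta>: "\<theta> \<in> S\<^sub>\<Theta>" and \<gamma>: "\<gamma> \<in> S\<^sub>\<Gamma>" for \<theta> \<gamma>
  proof -
    have "elog (L_NR N E M Y y \<theta> \<gamma>) =
        (\<Sum>i=1..N. elog \<P>(\<omega> in M \<theta> \<gamma>. \<forall>j\<in>in_nbrs E i. Y j i \<omega> = y j i))"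
      unfolding L_NR_def by (intro elog_prod measure_nonneg)
    also have "\<dots> = (\<Sum>i=1..N. g_obj C R p q \<theta> \<gamma> (score_count E r y i))"
    proof (rule sum.cong[OF refl])
      fix i assume i: "i \<in> {1..N}"
      show "elog \<P>(\<omega> in M \<theta> \<gamma>. \<forall>j\<in>in_nbrs E i. Y j i \<omega> = y j i) =
        g_obj C R p q \<theta> \<gamma> (score_count E r y i)"
        unfolding g_obj_def
        by (intro arg_cong[where f = elog] prob_received_scores[OF graph i states scores
              \<theta>[unfolded S\<^sub>\<Theta>_def] \<gamma>[unfolded S\<^sub>\<Gamma>_def] law[OF \<theta> \<gamma>] observed])
    qed
    finally show ?thesis .
  qed
  have L_nonneg: "0 \<le> L_NR N E M Y y \<theta> \<gamma>" for \<theta> \<gamma>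
    unfolding L_NR_def by (intro prod_nonneg measure_nonneg ballI)
  show ?thesis
    unfolding JPH_NR_def
    \<comment> \<open>Strict monotonicity of \<open>elog\<close> transfers the comparisons. Keeping
      \<open>1\<close> unexpanded lets the sums over \<open>{1..N}\<close> match
      \<open>elog_L\<close>.\<close>
    by (intro argmax_set_cong_less)
      (auto simp: elog_L[symmetric] elog_less_iff L_nonneg simp del: One_nat_def)
qed

end
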